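(* Let $G$ be a bipartite analytic graph on a Polish space $X$ which has at least one edge. Then $G \preceq_B G^{*}$ and $G^{*} \not\preceq_B G$.
   Context: A graph $G$ on a Polish space $X$ is identified with its (symmetric, irreflexive) edge relation $G \subseteq X \times X$; it is analytic (resp. Borel) if this edge relation is an analytic (resp. Borel) subset of $X\times X$. For graphs $G$ on $X$ and $H$ on $Y$ (Polish spaces), a homomorphism from $G$ to $H$ is a map $h\colon X\to Y$ with $x \mathrel{G} y \Rightarrow h(x) \mathrel{H} h(y)$; we write $G \preceq_B H$ if there is a Borel such homomorphism. For a graph $G$ on $X$, the graph $G^{*}$ (Louveau jump) is the graph on $X^{\omega}$ (product topology) defined by $x \mathrel{G^{*}} y$ iff there is $n$ such that for all $i\ge n$, $x(i) \mathrel{G} y(i)$. *)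

theory Defs
  imports "HOL-Analysis.Analysis"
begin

instance prod :: (polish_space, polish_space) polish_space ..

text \<open>A graph on a type is its edge relation, a set of ordered pairs.\<close>

definition is_graph :: "('a \<times> 'a) set \<Rightarrow> bool" where
  "is_graph G \<longleftrightarrow> sym G \<and> irrefl G"

text \<open>The two parts are arbitrary sets: no definability is required of the bipartition.\<close>

definition bipartite :: "('a \<times> 'a) set \<Rightarrow> bool" where
  "bipartite G \<longleftrightarrow> (\<exists>A. \<forall>(x, y) \<in> G. x \<in> A \<longleftrightarrow> y \<notin> A)"

text \<open>A nonempty set is a continuous image of a Polish space iff it is a continuous image of
  Baire space \<open>nat \<Rightarrow> nat\<close> (product of discrete spaces); the empty set, a continuous image
  of the empty Polish space, has to be added separately.\<close>

definition analytic_set :: "'a::polish_space set \<Rightarrow> bool" where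
  "analytic_set A \<longleftrightarrow>
     A = {} \<or> (\<exists>f :: (nat \<Rightarrow> nat) \<Rightarrow> 'a. continuous_on UNIV f \<and> range f = A)"

definition graph_hom :: "('a \<times> 'a) set \<Rightarrow> ('b \<times> 'b) set \<Rightarrow> ('a \<Rightarrow> 'b) \<Rightarrow> bool" where
  "graph_hom G H h \<longleftrightarrow> (\<forall>x y. (x, y) \<in> G \<longrightarrow> (h x, h y) \<in> H)"

definition borel_hom_le ::
    "('a::polish_space \<times> 'a) set \<Rightarrow> ('b::polish_space \<times> 'b) set \<Rightarrow> bool"
    (infix "\<preceq>\<^sub>B" 50) where
  "G \<preceq>\<^sub>B H \<longleftrightarrow> (\<exists>h. h \<in> borel \<rightarrow>\<^sub>M borel \<and> graph_hom G H h)"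

definition louveau_jump :: "('a \<times> 'a) set \<Rightarrow> ((nat \<Rightarrow> 'a) \<times> (nat \<Rightarrow> 'a)) set" where
  "louveau_jump G = {(x, y). \<exists>n. \<forall>i\<ge>n. (x i, y i) \<in> G}"

end

theory Submission
  imports Defs
begin

text \<open>Suppose \<open>h\<close> is a Borel homomorphism from the Louveau jump of \<open>G\<close> to \<open>G\<close>. As \<open>h\<close> allows one to
  pass to pointwise limits, every Borel set \<open>B\<close> of Baire space can be encoded in \<open>G\<close>: there are a
  Borel map \<open>k\<close> from Cantor space and a continuous \<open>\<phi>\<close> such that, whenever \<open>x + y = \<phi> z\<close>, the points
  \<open>k x\<close> and \<open>k y\<close> are adjacent if \<open>z \<in> B\<close> and have a common neighbour otherwise. The Borel
  complexity of \<open>k\<close> is irrelevant: \<open>k\<close> is continuous on a comeager set \<open>C\<close>, and \<open>x, y \<in> C\<close> can be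
  chosen continuously in \<open>z\<close>. Since a bipartite \<open>G\<close> has no triangles, Lusin's theorem separates \<open>G\<close>
  from \<open>G O G\<close> by a Borel set \<open>S\<close>, and every \<open>B\<close> would be a continuous preimage of this one \<open>S\<close>;
  diagonalising over codes of continuous functions refutes this.\<close>

section \<open>Open sets and cylinders in Baire and Cantor space\<close>

lemma open_fun_iff_cylinder:
  fixes U :: "(nat \<Rightarrow> 'a::discrete_topology) set"
  shows "open U \<longleftrightarrow> (\<forall>x\<in>U. \<exists>m. \<forall>y. (\<forall>i<m. y i = x i) \<longrightarrow> y \<in> U)"
proof
  assume "open U"
  then have U: "openin (product_topology (\<lambda>i. euclidean) UNIV) U"
    by (simp add: open_fun_def)
  show "\<forall>x\<in>U. \<exists>m. \<forall>y. (\<forall>i<m. y i = x i) \<longrightarrow> y \<in> U"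
  proof
    fix x assume "x \<in> U"
    from product_topology_open_contains_basis[OF U this]
    obtain X where X: "x \<in> (\<Pi>\<^sub>E i\<in>UNIV. X i)" "finite {i. X i \<noteq> UNIV}" "(\<Pi>\<^sub>E i\<in>UNIV. X i) \<subseteq> U"
      unfolding topspace_euclidean by metis
    obtain m where m: "\<And>i. X i \<noteq> UNIV \<Longrightarrow> i < m"
      using X(2) unfolding finite_nat_set_iff_bounded by auto
    have "y \<in> U" if "\<forall>i<m. y i = x i" for y
    proof -
      have "y i \<in> X i" for i
        using X(1) m[of i] that by (cases "i < m") (auto simp: PiE_iff)
      then show ?thesis using X(3) by (auto simp: PiE_iff)
    qed
    then show "\<exists>m. \<forall>y. (\<forall>i<m. y i = x i) \<longrightarrow> y \<in> U" by blast
  qed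
next
  assume R: "\<forall>x\<in>U. \<exists>m. \<forall>y. (\<forall>i<m. y i = x i) \<longrightarrow> y \<in> U"
  show "open U"
  proof (subst open_subopen, intro ballI)
    fix x assume "x \<in> U"
    then obtain m where m: "\<forall>y. (\<forall>i<m. y i = x i) \<longrightarrow> y \<in> U" using R by blast
    have "{y. \<forall>i<m. y i = x i} = (\<Inter>i\<in>{..<m}. (\<lambda>y. y i) -` {x i})" by auto
    moreover have "open (\<Inter>i\<in>{..<m}. (\<lambda>y::nat \<Rightarrow> 'a. y i) -` {x i})"
      by (intro open_INT ballI open_vimage continuous_on_product_coordinates open_discrete) auto
    ultimately have "open {y. \<forall>i<m. y i = x i}" by simp
    then show "\<exists>T. open T \<and> x \<in> T \<and> T \<subseteq> U"
      using m by (intro exI[of _ "{y. \<forall>i<m. y i = x i}"]) auto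
  qed
qed

section \<open>Lusin separation of disjoint analytic sets, applied to \<open>G\<close> and
  \<open>G O G\<close>\<close>

definition borel_separable :: "'a::topological_space set \<Rightarrow> 'a set \<Rightarrow> bool" where
  "borel_separable A B \<longleftrightarrow> (\<exists>S\<in>sets borel. A \<subseteq> S \<and> B \<inter> S = {})"

text \<open>If \<open>S i j\<close> separates \<open>A i\<close> from \<open>B j\<close>, then
  \<open>\<Union>i. \<Inter>j. S i j\<close> separates the unions. In contrapositive form, an
  inseparable pair of unions has an inseparable pair of pieces.\<close>

lemma borel_separable_UN:
  assumes "\<And>(i::nat) (j::nat). borel_separable (A i) (B j)"
  shows "borel_separable (\<Union>i. A i) (\<Union>j. B j)"
proof -
  obtain S where S: "\<And>i j. S i j \<in> sets borel \<and> A i \<subseteq> S i j \<and> B j \<inter> S i j = {}"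
    using assms unfolding borel_separable_def by metis
  have "(\<Union>i. \<Inter>j. S i j) \<in> sets borel"
    using S by (intro sets.countable_UN sets.countable_INT) auto
  moreover have "(\<Union>i. A i) \<subseteq> (\<Union>i. \<Inter>j. S i j)" "(\<Union>j. B j) \<inter> (\<Union>i. \<Inter>j. S i j) = {}" using S by blast+
  ultimately show ?thesis unfolding borel_separable_def by blast
qed

text \<open>Splitting inseparable images by one coordinate after another gives branches
  \<open>x\<close> in \<open>P\<close> and \<open>y\<close> in \<open>Q\<close> all of whose
  cylinders still have inseparable images. Yet \<open>f x\<close> and \<open>g y\<close> differ, and
  by continuity disjoint neighbourhoods of them contain the images of long enough cylinders. Closed
  domains are allowed so that \<open>G O G\<close> can be presented as the image of an
  equaliser.\<close>

lemma lusin_separation: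
  fixes f g :: "(nat \<Rightarrow> nat) \<Rightarrow> 'a::t2_space"
  assumes f: "continuous_on UNIV f" and g: "continuous_on UNIV g"
    and P: "closed P" and Q: "closed Q" and disj: "f ` P \<inter> g ` Q = {}"
  shows "borel_separable (f ` P) (g ` Q)"
proof (rule ccontr)
  assume nsep: "\<not> ?thesis"
  define cyl where "cyl s n = {y::nat \<Rightarrow> nat. \<forall>i<n. y i = s i}" for s :: "nat \<Rightarrow> nat" and n
  \<comment> \<open>At stage \<open>n\<close> only the first \<open>n\<close> entries of the two
    sequences in \<open>st\<close> matter; later stages overwrite the others.\<close>
  define R where "R n st \<longleftrightarrow> \<not> borel_separable (f ` (P \<inter> cyl (fst st) n)) (g ` (Q \<inter> cyl (snd st) n))"
    for n and st :: "(nat \<Rightarrow> nat) \<times> (nat \<Rightarrow> nat)"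
  have cylS: "cyl s n = (\<Union>i. cyl (s(n := i)) (Suc n))" for s n
  proof (rule set_eqI)
    fix y :: "nat \<Rightarrow> nat"
    have "y \<in> cyl (s(n := i)) (Suc n) \<longleftrightarrow> y \<in> cyl s n \<and> y n = i" for i
      unfolding cyl_def mem_Collect_eq by (metis fun_upd_apply less_Suc_eq less_irrefl)
    then show "y \<in> cyl s n \<longleftrightarrow> y \<in> (\<Union>i. cyl (s(n := i)) (Suc n))" by simp
  qed
  have "\<exists>F. \<forall>n. R n (F n) \<and> (\<exists>i j. F (Suc n) = ((fst (F n))(n := i), (snd (F n))(n := j)))"
  proof (rule dependent_nat_choice)
    show "\<exists>st. R 0 st" using nsep by (simp add: R_def cyl_def)
  next
    fix st n assume "R n st"
    have "\<exists>i j. R (Suc n) ((fst st)(n := i), (snd st)(n := j))"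
    proof (rule ccontr)
      assume "\<nexists>i j. R (Suc n) ((fst st)(n := i), (snd st)(n := j))"
      then have "borel_separable (f ` (P \<inter> cyl ((fst st)(n := i)) (Suc n)))
          (g ` (Q \<inter> cyl ((snd st)(n := j)) (Suc n)))" for i j by (simp add: R_def)
      then have "borel_separable (\<Union>i. f ` (P \<inter> cyl ((fst st)(n := i)) (Suc n)))
          (\<Union>j. g ` (Q \<inter> cyl ((snd st)(n := j)) (Suc n)))" by (rule borel_separable_UN)
      then have "\<not> R n st"
        unfolding R_def cylS[of "fst st" n] cylS[of "snd st" n] Int_UN_distrib image_UN by blast
      with \<open>R n st\<close> show False by simp
    qed
    then show "\<exists>st'. R (Suc n) st' \<and> (\<exists>i j. st' = ((fst st)(n := i), (snd st)(n := j)))" by blast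
  qed
  then obtain F where F: "\<And>n. R n (F n)"
    and FS: "\<And>n. \<exists>i j. F (Suc n) = ((fst (F n))(n := i), (snd (F n))(n := j))" by blast
  define x where "x i = fst (F (Suc i)) i" for i
  define y where "y i = snd (F (Suc i)) i" for i
  have agree: "fst (F n) i = x i \<and> snd (F n) i = y i" if "i < n" for n i
    using that
  proof (induction n)
    case (Suc n)
    obtain a b where ab: "F (Suc n) = ((fst (F n))(n := a), (snd (F n))(n := b))" using FS by blast
    show ?case
    proof (cases "i = n")
      case True then show ?thesis by (simp add: x_def y_def)
    next
      case False then show ?thesis using Suc ab by simp
    qed
  qed simp
  have cx: "cyl (fst (F n)) n = cyl x n" and cy: "cyl (snd (F n)) n = cyl y n" for n
    using agree[of _ n] by (auto simp: cyl_def)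
  have ns: "\<not> borel_separable (f ` (P \<inter> cyl x n)) (g ` (Q \<inter> cyl y n))" for n
    using F[of n] by (simp add: R_def cx cy)
  \<comment> \<open>An empty image is separated by \<open>{}\<close> or by \<open>UNIV\<close>. So
    all cylinders around \<open>x\<close> and \<open>y\<close> meet \<open>P\<close> and
    \<open>Q\<close>, and closedness puts the branches themselves there.\<close>
  have ne: "P \<inter> cyl x n \<noteq> {}" "Q \<inter> cyl y n \<noteq> {}" for n
  proof -
    show "P \<inter> cyl x n \<noteq> {}" using ns[of n] by (auto simp: borel_separable_def intro: bexI[of _ "{}"])
    show "Q \<inter> cyl y n \<noteq> {}" using ns[of n] by (auto simp: borel_separable_def intro: bexI[of _ UNIV])
  qed
  have xP: "x \<in> P"
  proof (rule ccontr)
    assume "x \<notin> P"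
    with P obtain m where "\<forall>u. (\<forall>i<m. u i = x i) \<longrightarrow> u \<in> - P"
      unfolding closed_def open_fun_iff_cylinder by blast
    then show False using ne(1)[of m] by (auto simp: cyl_def)
  qed
  have yQ: "y \<in> Q"
  proof (rule ccontr)
    assume "y \<notin> Q"
    with Q obtain m where "\<forall>u. (\<forall>i<m. u i = y i) \<longrightarrow> u \<in> - Q"
      unfolding closed_def open_fun_iff_cylinder by blast
    then show False using ne(2)[of m] by (auto simp: cyl_def)
  qed
  have "f x \<noteq> g y" using xP yQ disj by blast
  then obtain U V where UV: "open U" "open V" "f x \<in> U" "g y \<in> V" "U \<inter> V = {}"
    by (meson hausdorff)
  have "open (f -` U)" "open (g -` V)" using f g UV by (auto intro: open_vimage)
  moreover have "x \<in> f -` U" "y \<in> g -` V" using UV by auto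
  ultimately obtain m1 m2 where m1: "\<forall>u. (\<forall>i<m1. u i = x i) \<longrightarrow> u \<in> f -` U"
    and m2: "\<forall>u. (\<forall>i<m2. u i = y i) \<longrightarrow> u \<in> g -` V"
    unfolding open_fun_iff_cylinder by blast
  have "f ` (P \<inter> cyl x (max m1 m2)) \<subseteq> U" "g ` (Q \<inter> cyl y (max m1 m2)) \<inter> U = {}"
    using m1 m2 UV(5) by (auto simp: cyl_def)
  then have "borel_separable (f ` (P \<inter> cyl x (max m1 m2))) (g ` (Q \<inter> cyl y (max m1 m2)))"
    unfolding borel_separable_def using UV(1) by (intro bexI[of _ U]) auto
  then show False using ns by blast
qed

text \<open>One point \<open>y\<close> of Baire space codes two edges of \<open>G\<close> by its
  even and odd entries. The edges can be composed exactly when \<open>y\<close> lies in the closed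
  set \<open>Q\<close>, and \<open>g\<close> then yields the outer endpoints.\<close>

lemma analytic_separable_relcomp:
  fixes G :: "('a::polish_space \<times> 'a) set"
  assumes "analytic_set G" and disj: "G \<inter> (G O G) = {}"
  shows "borel_separable G (G O G)"
proof (cases "G = {}")
  case True
  then show ?thesis by (auto simp: borel_separable_def)
next
  case False
  then obtain f :: "(nat \<Rightarrow> nat) \<Rightarrow> 'a \<times> 'a" where f: "continuous_on UNIV f" "range f = G"
    using assms(1) by (auto simp: analytic_set_def)
  define ev od where "ev y n = y (2 * n)" and "od y n = y (2 * n + 1)" for y :: "nat \<Rightarrow> nat" and n :: nat
  have ev: "continuous_on UNIV ev" and od: "continuous_on UNIV od"
    unfolding ev_def od_def
    by (intro continuous_on_coordinatewise_then_product continuous_on_product_coordinates)+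
  have fe: "continuous_on UNIV (\<lambda>y. f (ev y))" and fo: "continuous_on UNIV (\<lambda>y. f (od y))"
    using continuous_on_compose2[OF f(1)] ev od by auto
  define Q where "Q = {y. snd (f (ev y)) = fst (f (od y))}"
  define g where "g y = (fst (f (ev y)), snd (f (od y)))" for y
  have "closed Q" unfolding Q_def using fe fo
    by (intro closed_Collect_eq continuous_intros)
  have g: "continuous_on UNIV g" unfolding g_def using fe fo by (intro continuous_intros)
  have GG: "g ` Q = G O G"
  proof
    have fG: "f u \<in> G" for u using f(2) by blast
    show "g ` Q \<subseteq> G O G"
    proof
      fix p assume "p \<in> g ` Q"
      then obtain y where y: "y \<in> Q" "p = g y" by blast
      have "(fst (f (ev y)), snd (f (ev y))) \<in> G" "(fst (f (od y)), snd (f (od y))) \<in> G"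
        by (simp_all add: fG)
      moreover have "snd (f (ev y)) = fst (f (od y))" using y(1) by (simp add: Q_def)
      ultimately show "p \<in> G O G" unfolding y(2) g_def by (metis relcompI)
    qed
    show "G O G \<subseteq> g ` Q"
    proof
      fix p assume "p \<in> G O G"
      then obtain a b c where "p = (a, c)" "(a, b) \<in> G" "(b, c) \<in> G" by blast
      moreover from this obtain u v where "f u = (a, b)" "f v = (b, c)" using f(2) by (metis imageE)
      moreover define y where "y n = (if even n then u (n div 2) else v (n div 2))" for n
      moreover have "ev y = u" "od y = v" by (auto simp: ev_def od_def y_def)
      ultimately show "p \<in> g ` Q" by (intro image_eqI[of _ _ y]) (auto simp: g_def Q_def)
    qed
  qed
  show ?thesis
    using lusin_separation[OF f(1) g closed_UNIV \<open>closed Q\<close>] disj f(2) GG by simp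
qed

section \<open>A Borel set that is not a continuous preimage of a given Borel set\<close>

text \<open>A continuous \<open>\<psi>\<close> is coded by a \<open>c\<close> that maps each finite sequence \<open>s\<close> to the index of a point
  of a countable dense set near \<open>\<psi>\<close> of an extension of \<open>s\<close>. The set \<open>D\<close> consists of those \<open>z\<close> at
  which the function coded by \<open>z\<close> itself has a value outside \<open>S\<close>.\<close>

lemma borel_not_continuous_preimage:
  fixes S :: "'a::polish_space set"
  assumes S: "S \<in> sets borel"
  obtains D :: "(nat \<Rightarrow> nat) set" where "D \<in> sets borel"
    "\<And>\<psi>. continuous_on UNIV \<psi> \<Longrightarrow> D \<noteq> \<psi> -` S"
proof -
  obtain E :: "'a set" where E: "countable E" "\<And>X. open X \<Longrightarrow> X \<noteq> {} \<Longrightarrow> \<exists>d\<in>E. d \<in> X"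
    using countable_dense_exists by blast
  define d where "d = from_nat_into E"
  have "E \<noteq> {}" using E(2)[of UNIV] by auto
  then have dE: "range d = E" using E(1) by (simp add: d_def)
  have dense: "\<exists>j. dist (d j) x < e" if "e > 0" for x e
    using E(2)[of "ball x e"] that dE by (metis ball_eq_empty dist_commute linorder_not_less mem_ball open_ball rangeE)
  define code :: "(nat \<Rightarrow> nat) \<Rightarrow> nat \<Rightarrow> nat" where "code z n = to_nat (map z [0..<n])" for z n
  define a where "a n z = d (z (code z n))" for n z
  have a_meas[measurable]: "a n \<in> borel \<rightarrow>\<^sub>M borel" for n
  proof (rule borel_measurable_continuous_onI, unfold continuous_on_open_vimage[OF open_UNIV], intro allI impI)
    fix B :: "'a set" assume "open B"
    \<comment> \<open>\<open>a n z\<close> reads \<open>z\<close> only below \<open>n\<close> and at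
      the position \<open>code z n\<close>; agreement up to both suffices.\<close>
    have "y \<in> a n -` B" if "z \<in> a n -` B" "\<forall>i<max n (Suc (code z n)). y i = z i" for y z
    proof -
      have "code y n = code z n" using that(2) by (auto simp: code_def)
      then show ?thesis using that by (simp add: a_def)
    qed
    then show "open (a n -` B \<inter> UNIV)" unfolding open_fun_iff_cylinder by (metis Int_UNIV_right)
  qed
  \<comment> \<open>The default \<open>d 0\<close> makes the sequence converge for every
    \<open>z\<close>, so that \<open>L\<close> is a pointwise limit of Borel maps and hence
    Borel.\<close>
  define b where "b n z = (if Cauchy (\<lambda>n. a n z) then a n z else d 0)" for n z
  define L where "L z = lim (\<lambda>n. b n z)" for z
  have "{z \<in> space borel. Cauchy (\<lambda>n. a n z)} \<in> sets borel" by (rule sets_Collect_Cauchy) simp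
  then have b_meas: "b n \<in> borel \<rightarrow>\<^sub>M borel" for n
    unfolding b_def by (intro measurable_If) (auto simp: pred_def)
  have "Cauchy (\<lambda>n. b n z)" for z
    by (cases "Cauchy (\<lambda>n. a n z)") (auto simp: b_def intro: LIMSEQ_imp_Cauchy[OF tendsto_const])
  then have bL: "(\<lambda>n. b n z) \<longlonglongrightarrow> L z" for z
    unfolding L_def by (simp add: Cauchy_convergent_iff convergent_LIMSEQ_iff)
  have "L \<in> borel \<rightarrow>\<^sub>M borel"
    by (rule borel_measurable_LIMSEQ_metric[OF b_meas bL])
  then have "L -` S \<inter> space borel \<in> sets borel" using S by (rule measurable_sets)
  then have "- (L -` S) \<in> sets borel" by (simp add: borel_comp)
  moreover have "- (L -` S) \<noteq> \<psi> -` S" if \<psi>: "continuous_on UNIV \<psi>" for \<psi>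
  proof -
    define ext :: "nat list \<Rightarrow> nat \<Rightarrow> nat" where "ext s i = (if i < length s then s ! i else 0)" for s i
    have "\<forall>s. \<exists>j. dist (d j) (\<psi> (ext s)) < 1 / Suc (length s)"
      by (intro allI dense) simp
    then obtain pick where pick: "\<And>s. dist (d (pick s)) (\<psi> (ext s)) < 1 / Suc (length s)"
      by metis
    \<comment> \<open>The choice of \<open>pick\<close> depends on \<open>\<psi>\<close> alone, so
      \<open>c\<close> may be fed to itself: \<open>a n c\<close> approximates \<open>\<psi>\<close>
      at the first \<open>n\<close> entries of \<open>c\<close> padded by zeros. In the limit
      \<open>L c = \<psi> c\<close>, and \<open>c\<close> is the diagonal point.\<close>
    define c where "c k = pick (from_nat k)" for k
    have "(\<lambda>n. ext (map c [0..<n])) \<longlonglongrightarrow> c"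
    proof (rule topological_tendstoI)
      fix U assume "open U" "c \<in> U"
      then obtain m where "\<forall>y. (\<forall>i<m. y i = c i) \<longrightarrow> y \<in> U" unfolding open_fun_iff_cylinder by blast
      then show "\<forall>\<^sub>F n in sequentially. ext (map c [0..<n]) \<in> U"
        by (intro eventually_sequentiallyI[of m]) (auto simp: ext_def)
    qed
    then have lim\<psi>: "(\<lambda>n. \<psi> (ext (map c [0..<n]))) \<longlonglongrightarrow> \<psi> c"
      by (intro continuous_on_tendsto_compose[OF \<psi>]) auto
    have "dist (a n c) (\<psi> (ext (map c [0..<n]))) < 1 / Suc n" for n
      using pick[of "map c [0..<n]"] by (simp add: a_def code_def c_def)
    then have "(\<lambda>n. dist (a n c) (\<psi> (ext (map c [0..<n])))) \<longlonglongrightarrow> 0"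
      by (intro real_tendsto_sandwich[OF _ _ tendsto_const LIMSEQ_Suc[OF lim_1_over_n]]) (auto intro: less_imp_le eventuallyI)
    moreover have "(\<lambda>n. dist (\<psi> (ext (map c [0..<n]))) (\<psi> c)) \<longlonglongrightarrow> 0"
      using lim\<psi> by (rule tendsto_dist_iff[THEN iffD1])
    ultimately have "(\<lambda>n. dist (a n c) (\<psi> (ext (map c [0..<n]))) + dist (\<psi> (ext (map c [0..<n]))) (\<psi> c)) \<longlonglongrightarrow> 0"
      by (rule tendsto_add_zero)
    from real_tendsto_sandwich[OF _ _ tendsto_const this, of "\<lambda>n. dist (a n c) (\<psi> c)"]
    have "(\<lambda>n. dist (a n c) (\<psi> c)) \<longlonglongrightarrow> 0"
      by (simp add: dist_triangle)
    then have ac: "(\<lambda>n. a n c) \<longlonglongrightarrow> \<psi> c" by (rule tendsto_dist_iff[THEN iffD2])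
    then have "Cauchy (\<lambda>n. a n c)" by (rule LIMSEQ_imp_Cauchy)
    then have "(\<lambda>n. b n c) = (\<lambda>n. a n c)" by (simp add: b_def)
    then have "L c = \<psi> c" using ac bL[of c] by (metis LIMSEQ_unique)
    then have "c \<in> - (L -` S) \<longleftrightarrow> c \<notin> \<psi> -` S" by simp
    then show ?thesis by metis
  qed
  ultimately show thesis by (rule that)
qed

section \<open>Borel sets as iterated limits of clopen sets\<close>

text \<open>The limit rule is shaped after the Louveau jump, which likewise asks for a condition at
  all but finitely many indices.\<close>

inductive clopen_limit :: "'a::topological_space set \<Rightarrow> bool" where
  clopen: "open A \<Longrightarrow> closed A \<Longrightarrow> clopen_limit A"
| limit: "(\<And>n::nat. clopen_limit (B n)) \<Longrightarrow> (\<And>z. \<forall>\<^sub>F n in sequentially. z \<in> B n \<longleftrightarrow> z \<in> A)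
    \<Longrightarrow> clopen_limit A"

lemma clopen_limit_Compl: "clopen_limit A \<Longrightarrow> clopen_limit (- A)"
proof (induction rule: clopen_limit.induct)
  case (clopen A)
  then show ?case by (intro clopen_limit.clopen) auto
next
  case (limit B A)
  show ?case by (rule clopen_limit.limit[of "\<lambda>n. - B n"]) (use limit in auto)
qed

text \<open>Union with a fixed set preserves eventual agreement, so limits can be treated in one
  argument at a time.\<close>

lemma clopen_limit_Un:
  assumes "clopen_limit A" "clopen_limit B"
  shows "clopen_limit (A \<union> B)"
  using assms
proof (induction arbitrary: B rule: clopen_limit.induct)
  case (clopen A)
  from clopen(3) show ?case
  proof (induction rule: clopen_limit.induct)
    case (clopen B)
    then show ?case using \<open>open A\<close> \<open>closed A\<close> by (intro clopen_limit.clopen) auto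
  next
    case (limit F B)
    show ?case
      by (rule clopen_limit.limit[of "\<lambda>n. A \<union> F n", OF limit(3) eventually_mono[OF limit(2)]]) auto
  qed
next
  case (limit F A)
  show ?case
    by (rule clopen_limit.limit[of "\<lambda>n. F n \<union> B", OF limit(3)[OF limit(4)] eventually_mono[OF limit(2)]]) auto
qed

lemma clopen_limit_UN:
  assumes "\<And>n::nat. clopen_limit (A n)"
  shows "clopen_limit (\<Union>n. A n)"
proof (rule clopen_limit.limit[of "\<lambda>n. \<Union>i\<le>n. A i"])
  show "clopen_limit (\<Union>i\<le>n. A i)" for n
    by (induction n) (auto simp: atMost_Suc assms intro: clopen_limit_Un)
  show "\<forall>\<^sub>F n in sequentially. z \<in> (\<Union>i\<le>n. A i) \<longleftrightarrow> z \<in> (\<Union>n. A n)" for z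
  proof (cases "\<exists>i. z \<in> A i")
    case True
    then obtain i where "z \<in> A i" by blast
    then show ?thesis by (intro eventually_sequentiallyI[of i]) auto
  qed auto
qed

lemma borel_imp_clopen_limit:
  fixes S :: "(nat \<Rightarrow> 'a::discrete_topology) set"
  assumes "S \<in> sets borel"
  shows "clopen_limit S"
proof -
  have "S \<in> sigma_sets UNIV (Collect open)" using assms by (simp add: borel_def)
  then show ?thesis
  proof (induction rule: sigma_sets.induct)
    case (Basic U)
    \<comment> \<open>\<open>C n\<close> is the union of the cylinders of length \<open>n\<close>
      inside \<open>U\<close>. Membership depends on the first \<open>n\<close> coordinates, so it
      is clopen, and the sets increase to \<open>U\<close>.\<close>
    define C where "C n = {z. \<forall>y. (\<forall>i<n. y i = z i) \<longrightarrow> y \<in> U}" for n :: nat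
    have "open (C n)" "open (- C n)" for n
      unfolding open_fun_iff_cylinder C_def by (auto 0 4 intro!: exI[of _ n])
    then have "clopen_limit (C n)" for n by (intro clopen) (auto simp: closed_def)
    moreover have "\<forall>\<^sub>F n in sequentially. z \<in> C n \<longleftrightarrow> z \<in> U" for z
    proof (cases "z \<in> U")
      case True
      with Basic obtain m where "\<forall>y. (\<forall>i<m. y i = z i) \<longrightarrow> y \<in> U"
        by (auto simp: open_fun_iff_cylinder)
      then show ?thesis using True by (intro eventually_sequentiallyI[of m]) (auto simp: C_def)
    qed (auto simp: C_def intro!: always_eventually)
    ultimately show ?case by (rule clopen_limit.limit)
  next
    case Empty
    show ?case by (intro clopen) auto
  next
    case (Compl A)
    then show ?case using clopen_limit_Compl[of A] by (simp add: Compl_eq_Diff_UNIV)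
  next
    case (Union A)
    then show ?case by (intro clopen_limit_UN)
  qed
qed

section \<open>Baire category: continuity on a comeager set and sums of its points\<close>

definition dense_open :: "'a::topological_space set \<Rightarrow> bool" where
  "dense_open U \<longleftrightarrow> open U \<and> (\<forall>W. open W \<longrightarrow> W \<noteq> {} \<longrightarrow> W \<inter> U \<noteq> {})"

lemma dense_open_Int:
  assumes "dense_open U" "dense_open V"
  shows "dense_open (U \<inter> V)"
  unfolding dense_open_def
proof (intro conjI allI impI)
  show "open (U \<inter> V)" using assms by (auto simp: dense_open_def)
  fix W :: "'a set" assume "open W" "W \<noteq> {}"
  then have "open (W \<inter> U)" "W \<inter> U \<noteq> {}" using assms(1) by (auto simp: dense_open_def)
  then have "(W \<inter> U) \<inter> V \<noteq> {}" using assms(2) unfolding dense_open_def by blast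
  then show "W \<inter> (U \<inter> V) \<noteq> {}" by (simp add: Int_assoc)
qed

lemma dense_open_INT:
  assumes "finite I" "\<And>i. i \<in> I \<Longrightarrow> dense_open (U i)"
  shows "dense_open (\<Inter>i\<in>I. U i)"
  using assms by (induction I rule: finite_induct) (auto simp: dense_open_def[of UNIV] intro: dense_open_Int)

text \<open>This is the Baire property of Borel sets. Comeager sets appear throughout as
  intersections of sequences of dense open sets.\<close>

lemma borel_almost_open:
  fixes A :: "'a::topological_space set"
  assumes "A \<in> sets borel"
  shows "\<exists>(U::nat \<Rightarrow> 'a set) V. (\<forall>n. dense_open (U n)) \<and> open V \<and> A \<inter> (\<Inter>n. U n) = V \<inter> (\<Inter>n. U n)"
proof -
  have "A \<in> sigma_sets UNIV (Collect open)" using assms by (simp add: borel_def)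
  then show ?thesis
  proof (induction rule: sigma_sets.induct)
    case (Basic A)
    then show ?case by (intro exI[of _ "\<lambda>_. UNIV"] exI[of _ A]) (auto simp: dense_open_def)
  next
    case Empty
    show ?case by (intro exI[of _ "\<lambda>_. UNIV"] exI[of _ "{}"]) (auto simp: dense_open_def)
  next
    case (Compl A)
    then obtain U V where U: "\<And>n::nat. dense_open (U n)" and V: "open V"
      and eq: "A \<inter> (\<Inter>n. U n) = V \<inter> (\<Inter>n. U n)" by blast
    \<comment> \<open>The extra set at index 0 deletes the boundary of \<open>V\<close>; off it
      \<open>V\<close> and \<open>closure V\<close> coincide, so the complement of \<open>A\<close>
      agrees with an open set.\<close>
    define U' where "U' n = (case n of 0 \<Rightarrow> V \<union> - closure V | Suc n \<Rightarrow> U n)" for n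
    have "W \<inter> (V \<union> - closure V) \<noteq> {}" if "open W" "W \<noteq> {}" for W
    proof (cases "W \<subseteq> closure V")
      case True
      then have "W \<inter> closure V \<noteq> {}" using that by blast
      then show ?thesis using that open_Int_closure_eq_empty[of W V] by blast
    qed auto
    then have "dense_open (V \<union> - closure V)" using V unfolding dense_open_def by auto
    then have "dense_open (U' n)" for n using U by (auto simp: U'_def split: nat.split)
    moreover have "x \<in> A \<longleftrightarrow> x \<in> closure V" if "x \<in> (\<Inter>n. U' n)" for x
    proof -
      have x: "x \<in> U' n" for n using that by blast
      have "x \<in> V \<longleftrightarrow> x \<in> closure V"
        using x[of 0] closure_subset[of V] by (auto simp: U'_def)
      moreover have "x \<in> (\<Inter>n. U n)"
        using x[of "Suc n" for n] by (simp add: U'_def)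
      then have "x \<in> A \<longleftrightarrow> x \<in> V" using eq by (metis IntD1 IntI)
      ultimately show ?thesis by simp
    qed
    then have "(UNIV - A) \<inter> (\<Inter>n. U' n) = - closure V \<inter> (\<Inter>n. U' n)" by auto
    ultimately show ?case
      by (intro exI[of _ U'] exI[of _ "- closure V"]) (simp add: open_Compl)
  next
    case (Union A)
    then obtain U V where U: "\<And>i n::nat. dense_open (U i n)" and V: "\<And>i. open (V i)"
      and eq: "\<And>i. A i \<inter> (\<Inter>n. U i n) = V i \<inter> (\<Inter>n. U i n)" by metis
    define U' where "U' k = U (fst (prod_decode k)) (snd (prod_decode k))" for k
    have "x \<in> A i \<longleftrightarrow> x \<in> V i" if "x \<in> (\<Inter>k. U' k)" for x i
    proof -
      have x: "x \<in> U' k" for k using that by blast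
      have "x \<in> (\<Inter>n. U i n)"
        using x[of "prod_encode (i, n)" for n] by (simp add: U'_def)
      then show ?thesis using eq[of i] by (metis IntD1 IntI)
    qed
    then have "(\<Union>i. A i) \<inter> (\<Inter>k. U' k) = (\<Union>i. V i) \<inter> (\<Inter>k. U' k)" by auto
    moreover have "dense_open (U' k)" for k using U by (simp add: U'_def)
    ultimately show ?case using V
      by (intro exI[of _ U'] exI[of _ "\<Union>i. V i"]) (simp add: open_UN)
  qed
qed

text \<open>The preimage of each of countably many basic open sets agrees with an open set on a
  comeager set. On the intersection of these comeager sets all preimages of open sets are relatively
  open.\<close>

lemma borel_measurable_continuous_on_dense_open:
  fixes k :: "'a::topological_space \<Rightarrow> 'b::second_countable_topology"
  assumes "k \<in> borel \<rightarrow>\<^sub>M borel"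
  obtains U :: "nat \<Rightarrow> 'a set" where "\<And>n. dense_open (U n)" "continuous_on (\<Inter>n. U n) k"
proof -
  obtain B :: "'b set set" where B: "countable B" "\<And>C. C \<in> B \<Longrightarrow> open C"
    "\<And>S. open S \<Longrightarrow> \<exists>\<C>. \<C> \<subseteq> B \<and> S = \<Union>\<C>"
    using univ_second_countable by metis
  have Bne: "B \<noteq> {}" using B(3)[of UNIV] by auto
  define b where "b = from_nat_into B"
  have bB: "range b = B" using B(1) Bne by (simp add: b_def)
  have "k -` b i \<in> sets borel" for i
  proof -
    have "open (b i)" using B(2) bB by blast
    then show ?thesis using measurable_sets[OF assms, of "b i"] by simp
  qed
  from borel_almost_open[OF this] obtain U V where U: "\<And>i n::nat. dense_open (U i n)"
    and V: "\<And>i. open (V i)" and eq: "\<And>i. k -` b i \<inter> (\<Inter>n. U i n) = V i \<inter> (\<Inter>n. U i n)"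
    by metis
  define U' where "U' k = U (fst (prod_decode k)) (snd (prod_decode k))" for k
  define C where "C = (\<Inter>k. U' k)"
  have eqC: "k x \<in> b i \<longleftrightarrow> x \<in> V i" if "x \<in> C" for x i
  proof -
    have x: "x \<in> U' k" for k using that by (simp add: C_def)
    have "x \<in> (\<Inter>n. U i n)"
      using x[of "prod_encode (i, n)" for n] by (simp add: U'_def)
    then show ?thesis using eq[of i] by (metis IntD1 IntI vimage_eq)
  qed
  have "continuous_on C k"
    unfolding continuous_on_open_invariant
  proof (intro allI impI)
    fix S :: "'b set" assume "open S"
    then obtain \<C> where \<C>: "\<C> \<subseteq> B" "S = \<Union>\<C>" using B(3) by blast
    define I where "I = {i. b i \<in> \<C>}"
    have "S = (\<Union>i\<in>I. b i)" using \<C> bB unfolding I_def by blast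
    then have "(\<Union>i\<in>I. V i) \<inter> C = k -` S \<inter> C" using eqC by auto
    then show "\<exists>A. open A \<and> A \<inter> C = k -` S \<inter> C"
      using V by (intro exI[of _ "\<Union>i\<in>I. V i"]) (simp add: open_UN)
  qed
  moreover have "dense_open (U' k)" for k using U by (simp add: U'_def)
  ultimately show thesis unfolding C_def by (intro that)
qed

text \<open>The intersection of the translates of \<open>U\<close> under the finitely many changes of the first \<open>m\<close>
  coordinates is still dense open.\<close>

lemma dense_open_block:
  fixes U :: "(nat \<Rightarrow> bool) set"
  assumes U: "dense_open U"
  shows "\<exists>m'>m. \<exists>p. \<forall>x. (\<forall>i. m \<le> i \<and> i < m' \<longrightarrow> x i = p i) \<longrightarrow> x \<in> U"
proof -
  define flip :: "nat set \<Rightarrow> (nat \<Rightarrow> bool) \<Rightarrow> nat \<Rightarrow> bool" where "flip T x i = (x i \<noteq> (i \<in> T))" for T x i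
  have flip2: "flip T (flip T x) = x" for T x by (auto simp: flip_def)
  have open_flip: "open (flip T -` W)" if "open W" for T W
    unfolding open_fun_iff_cylinder
  proof
    fix x assume "x \<in> flip T -` W"
    with that obtain n where n: "\<forall>y. (\<forall>i<n. y i = flip T x i) \<longrightarrow> y \<in> W"
      unfolding open_fun_iff_cylinder by blast
    then show "\<exists>n. \<forall>y. (\<forall>i<n. y i = x i) \<longrightarrow> y \<in> flip T -` W"
      by (intro exI[of _ n]) (simp add: flip_def)
  qed
  have "dense_open (flip T -` U)" for T
    unfolding dense_open_def
  proof (intro conjI allI impI)
    show "open (flip T -` U)" using U open_flip by (simp add: dense_open_def)
    fix W :: "(nat \<Rightarrow> bool) set" assume W: "open W" "W \<noteq> {}"
    then obtain w where "w \<in> W" by blast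
    then have "flip T w \<in> flip T -` W" by (simp add: flip2)
    then obtain v where "v \<in> flip T -` W" "v \<in> U"
      using U open_flip[OF W(1), of T] unfolding dense_open_def by blast
    then have "flip T v \<in> W \<inter> flip T -` U" by (simp add: flip2)
    then show "W \<inter> flip T -` U \<noteq> {}" by blast
  qed
  then have V: "dense_open (\<Inter>T\<in>Pow {..<m}. flip T -` U)" (is "dense_open ?V")
    by (intro dense_open_INT) auto
  then obtain p where "p \<in> ?V" unfolding dense_open_def by (metis UNIV_not_empty disjoint_iff ex_in_conv open_UNIV)
  with V obtain k where k: "\<forall>y. (\<forall>i<k. y i = p i) \<longrightarrow> y \<in> ?V"
    unfolding dense_open_def open_fun_iff_cylinder by blast
  \<comment> \<open>The maximum with \<open>Suc m\<close> keeps the block nonempty when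
    \<open>k \<le> m\<close>.\<close>
  have "x \<in> U" if x: "\<forall>i. m \<le> i \<and> i < max k (Suc m) \<longrightarrow> x i = p i" for x
  proof -
    \<comment> \<open>Flipping \<open>x\<close> on \<open>T\<close> makes it agree with
      \<open>p\<close> below \<open>k\<close>, hence lie in \<open>?V\<close>; the component of
      \<open>?V\<close> for this same \<open>T\<close> undoes the flip.\<close>
    define T where "T = {i. i < m \<and> x i \<noteq> p i}"
    have "flip T x i = p i" if "i < k" for i
      using x[rule_format, of i] that by (cases "i < m") (auto simp: flip_def T_def)
    then have "flip T x \<in> ?V" using k by blast
    moreover have "T \<in> Pow {..<m}" by (auto simp: T_def)
    ultimately have "flip T (flip T x) \<in> U" by blast
    then show ?thesis by (simp add: flip2)
  qed
  then show ?thesis by (intro exI[of _ "max k (Suc m)"] conjI exI[of _ p]) auto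
qed

text \<open>There are a point \<open>P\<close> and a partition of the coordinates into blocks such that agreeing with \<open>P\<close>
  on infinitely many blocks implies membership in all \<open>U n\<close>. So \<open>x z\<close> may copy \<open>P\<close> on the even
  blocks and \<open>y z\<close> on the odd ones, and the remaining bits are free to make the sum \<open>\<phi> z\<close>.\<close>

lemma comeager_continuous_sum:
  fixes U :: "nat \<Rightarrow> (nat \<Rightarrow> bool) set" and \<phi> :: "'z::topological_space \<Rightarrow> nat \<Rightarrow> bool"
  assumes U: "\<And>n. dense_open (U n)" and \<phi>: "continuous_on UNIV \<phi>"
  obtains x y where "continuous_on UNIV x" "continuous_on UNIV y"
    "range x \<subseteq> (\<Inter>n. U n)" "range y \<subseteq> (\<Inter>n. U n)" "\<And>z i. \<phi> z i \<longleftrightarrow> x z i \<noteq> y z i"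
proof -
  \<comment> \<open>Asking for all \<open>U j\<close> with \<open>j \<le> n\<close>, not just for
    \<open>U n\<close>, is what makes any infinite set of blocks sufficient.\<close>
  define R where "R n m k p \<longleftrightarrow> (\<forall>x. (\<forall>i. m \<le> i \<and> i < k \<longrightarrow> x i = p i) \<longrightarrow> x \<in> (\<Inter>j\<le>n. U j))" for n m k p
  have "\<exists>k>m. \<exists>p. R n m k p" for n m
    unfolding R_def by (intro dense_open_block dense_open_INT U) simp
  then have ex: "\<exists>k. m < k \<and> (\<exists>p. R n m k p)" for n m by blast
  define m' where "m' n m = (SOME k. m < k \<and> (\<exists>p. R n m k p))" for n m
  define p where "p n m = (SOME p. R n m (m' n m) p)" for n m
  have m'_ex: "m < m' n m \<and> (\<exists>p. R n m (m' n m) p)" for n m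
    unfolding m'_def by (rule someI_ex[OF ex])
  then have m': "m < m' n m" and "\<exists>p. R n m (m' n m) p" for n m by blast+
  from someI_ex[OF this(2)] have R: "R n m (m' n m) (p n m)" for n m
    unfolding p_def by this
  have p: "x \<in> (\<Inter>j\<le>n. U j)" if "\<And>i. m \<le> i \<Longrightarrow> i < m' n m \<Longrightarrow> x i = p n m i" for n m x
    using R[of n m] that unfolding R_def by blast
  define M where "M = rec_nat 0 (\<lambda>n m. m' n m)"
  have M: "M 0 = 0" "M (Suc n) = m' n (M n)" for n by (simp_all add: M_def)
  have smono: "strict_mono M" using m' by (simp add: strict_mono_Suc_iff M)
  define blk where "blk i = (LEAST n. i < M (Suc n))" for i
  have blk: "blk i = n" if "M n \<le> i" "i < M (Suc n)" for i n
    unfolding blk_def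
  proof (rule Least_equality)
    fix l assume "i < M (Suc l)"
    with that(1) have "M n < M (Suc l)" by simp
    then show "n \<le> l" using smono by (simp add: strict_mono_less)
  qed fact
  define P where "P i = p (blk i) (M (blk i)) i" for i
  have in_U: "x \<in> (\<Inter>n. U n)" if "\<And>j. \<exists>n\<ge>j. \<forall>i. blk i = n \<longrightarrow> x i = P i" for x
  proof
    fix j
    obtain n where n: "n \<ge> j" "\<forall>i. blk i = n \<longrightarrow> x i = P i" using \<open>\<exists>n\<ge>j. _ n\<close> by blast
    have "x \<in> (\<Inter>j\<le>n. U j)"
    proof (rule p)
      fix i assume "M n \<le> i" "i < m' n (M n)"
      then have "blk i = n" using blk M by simp
      then show "x i = p n (M n) i" using n(2) by (simp add: P_def)
    qed
    then show "x \<in> U j" using n(1) by blast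
  qed
  define x where "x z i = (if even (blk i) then P i else P i \<noteq> \<phi> z i)" for z i
  define y where "y z i = (if odd (blk i) then P i else P i \<noteq> \<phi> z i)" for z i
  have cont: "continuous_on UNIV (\<lambda>z. if c then a else a \<noteq> \<phi> z i)" for c a i
  proof -
    have "continuous_on UNIV (\<lambda>z. \<phi> z i)" using \<phi> by (rule continuous_on_product_then_coordinatewise)
    then have "continuous_on UNIV ((\<lambda>b. a \<noteq> b) \<circ> (\<lambda>z. \<phi> z i))"
      by (rule continuous_on_compose) (auto simp: continuous_on_open_invariant open_discrete)
    then show ?thesis by (cases c) (auto simp: o_def)
  qed
  show thesis
  proof
    show "continuous_on UNIV x" "continuous_on UNIV y"
      unfolding x_def y_def by (intro continuous_on_coordinatewise_then_product cont)+
    have "x z \<in> (\<Inter>n. U n)" for z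
    proof (rule in_U)
      show "\<exists>n\<ge>j. \<forall>i. blk i = n \<longrightarrow> x z i = P i" for j by (intro exI[of _ "2 * j"]) (auto simp: x_def)
    qed
    then show "range x \<subseteq> (\<Inter>n. U n)" by blast
    have "y z \<in> (\<Inter>n. U n)" for z
    proof (rule in_U)
      show "\<exists>n\<ge>j. \<forall>i. blk i = n \<longrightarrow> y z i = P i" for j by (intro exI[of _ "2 * j + 1"]) (auto simp: y_def)
    qed
    then show "range y \<subseteq> (\<Inter>n. U n)" by blast
    show "\<phi> z i \<longleftrightarrow> x z i \<noteq> y z i" for z i by (auto simp: x_def y_def)
  qed
qed

section \<open>Encoding Borel sets of Baire space in \<open>G\<close>\<close>

text \<open>Saying \<open>k x\<close> is adjacent to the value at the complement of \<open>y\<close>, rather than that \<open>k x\<close> and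
  \<open>k y\<close> have a common neighbour, keeps the condition a single edge of \<open>G\<close>, which \<open>h\<close> preserves.\<close>

definition cantor_reducible :: "('a::topological_space \<times> 'a) set \<Rightarrow> 'z::topological_space set \<Rightarrow> bool" where
  "cantor_reducible G B \<longleftrightarrow> (\<exists>(k :: (nat \<Rightarrow> bool) \<Rightarrow> 'a) \<phi>. k \<in> borel \<rightarrow>\<^sub>M borel \<and> continuous_on UNIV \<phi> \<and>
    (\<forall>y. (k y, k (\<lambda>i. \<not> y i)) \<in> G) \<and>
    (\<forall>z x y. (\<forall>i. \<phi> z i \<longleftrightarrow> x i \<noteq> y i) \<longrightarrow> (k x, k (if z \<in> B then y else (\<lambda>i. \<not> y i))) \<in> G))"

text \<open>A single bit and a single edge suffice: \<open>k\<close> picks an endpoint by the bit at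
  0, and \<open>\<phi> z\<close> tells whether the bits of \<open>x\<close> and \<open>y\<close>
  differ. Complementing \<open>y\<close> turns equal bits into different ones.\<close>

lemma cantor_reducible_clopen:
  assumes "open B" "closed B" "sym G" "(a, b) \<in> G"
  shows "cantor_reducible G B"
proof -
  define k where "k x = (if x 0 then a else b)" for x :: "nat \<Rightarrow> bool"
  define \<phi> where "\<phi> z = (\<lambda>i::nat. z \<in> B)" for z
  have ba: "(b, a) \<in> G" using assms by (auto dest: symD)
  have "open {x :: nat \<Rightarrow> bool. x 0}"
    unfolding open_fun_iff_cylinder by (auto intro!: exI[of _ "Suc 0"])
  then have "k \<in> borel \<rightarrow>\<^sub>M borel"
    unfolding k_def by (intro measurable_If) (auto simp: pred_def)
  moreover have "continuous_on UNIV \<phi>"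
    unfolding \<phi>_def
  proof (intro continuous_on_coordinatewise_then_product)
    show "continuous_on UNIV (\<lambda>z. z \<in> B)"
      unfolding continuous_on_open_vimage[OF open_UNIV]
    proof (intro allI impI)
      fix T :: "bool set"
      have "(\<lambda>z. z \<in> B) -` T = (if True \<in> T then B else {}) \<union> (if False \<in> T then - B else {})"
      proof (rule set_eqI)
        fix z show "z \<in> (\<lambda>z. z \<in> B) -` T \<longleftrightarrow> z \<in> (if True \<in> T then B else {}) \<union> (if False \<in> T then - B else {})"
          by (cases "z \<in> B") auto
      qed
      then show "open ((\<lambda>z. z \<in> B) -` T \<inter> UNIV)" using assms by auto
    qed
  qed
  moreover have "(k x, k (if z \<in> B then y else (\<lambda>i. \<not> y i))) \<in> G"
    if "\<forall>i. \<phi> z i \<longleftrightarrow> x i \<noteq> y i" for x y z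
    using that[rule_format, of 0] assms(4) ba by (auto simp: k_def \<phi>_def)
  ultimately show ?thesis unfolding cantor_reducible_def using assms(4) ba
    by (intro exI[of _ k] exI[of _ \<phi>]) (auto simp: k_def)
qed

text \<open>The \<open>n\<close>-th reduction runs on the \<open>n\<close>-th column of the input,
  and \<open>h\<close> is applied to the sequence of values. For fixed \<open>z\<close>, almost
  every column decides \<open>z \<in> B n\<close> as \<open>z \<in> A\<close>, so the two sequences
  are adjacent in the jump and \<open>h\<close> returns an edge.\<close>

lemma cantor_reducible_limit:
  fixes G :: "('a::polish_space \<times> 'a) set"
  assumes h: "h \<in> borel \<rightarrow>\<^sub>M borel" "graph_hom (louveau_jump G) G h"
    and B: "\<And>n. cantor_reducible G (B n)" and lim: "\<And>z. \<forall>\<^sub>F n in sequentially. z \<in> B n \<longleftrightarrow> z \<in> A"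
  shows "cantor_reducible G A"
proof -
  have h_edge: "(h u, h v) \<in> G" if "\<forall>\<^sub>F n in sequentially. (u n, v n) \<in> G" for u v
    using that h(2) by (simp add: graph_hom_def louveau_jump_def eventually_sequentially)  from B obtain k :: "nat \<Rightarrow> (nat \<Rightarrow> bool) \<Rightarrow> 'a" and \<phi> where
    k: "\<And>n. k n \<in> borel \<rightarrow>\<^sub>M borel" and \<phi>: "\<And>n. continuous_on UNIV (\<phi> n)"
    and edge: "\<And>n y. (k n y, k n (\<lambda>i. \<not> y i)) \<in> G"
    and red: "\<And>n z x y. \<forall>i. \<phi> n z i \<longleftrightarrow> x i \<noteq> y i \<Longrightarrow>
        (k n x, k n (if z \<in> B n then y else (\<lambda>i. \<not> y i))) \<in> G"
    unfolding cantor_reducible_def by metis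
  define sect where "sect n x i = x (prod_encode (n, i))" for n and x :: "nat \<Rightarrow> bool" and i
  \<comment> \<open>Complementing the input complements every column, so the two cases of the
    reduction pass to the columns.\<close>
  have sect_not: "sect n (\<lambda>i. \<not> y i) = (\<lambda>i. \<not> sect n y i)" for n y by (rule ext) (simp add: sect_def)
  define K where "K x = h (\<lambda>n. k n (sect n x))" for x
  define \<Phi> where "\<Phi> z i = \<phi> (fst (prod_decode i)) z (snd (prod_decode i))" for z i
  have "sect n \<in> borel \<rightarrow>\<^sub>M borel" for n
    unfolding sect_def by (intro borel_measurable_continuous_onI continuous_on_coordinatewise_then_product
        continuous_on_product_coordinates)
  then have "(\<lambda>x. k n (sect n x)) \<in> borel \<rightarrow>\<^sub>M borel" for n using k measurable_compose by blast
  then have "(\<lambda>x n. k n (sect n x)) \<in> borel \<rightarrow>\<^sub>M borel"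
    by (rule measurable_coordinatewise_then_product)
  then have "K \<in> borel \<rightarrow>\<^sub>M borel" unfolding K_def using h(1) by (rule measurable_compose)
  moreover have "continuous_on UNIV \<Phi>" unfolding \<Phi>_def
    by (rule continuous_on_coordinatewise_then_product, rule continuous_on_product_then_coordinatewise, rule \<phi>)
  moreover have "(K y, K (\<lambda>i. \<not> y i)) \<in> G" for y
    unfolding K_def
  proof (rule h_edge, rule always_eventually, rule allI)
    fix n show "(k n (sect n y), k n (sect n (\<lambda>i. \<not> y i))) \<in> G"
      unfolding sect_not by (rule edge)
  qed
  moreover have "(K x, K (if z \<in> A then y else (\<lambda>i. \<not> y i))) \<in> G"
    if xy: "\<forall>i. \<Phi> z i \<longleftrightarrow> x i \<noteq> y i" for x y z
    unfolding K_def
  proof (rule h_edge, rule eventually_mono[OF lim])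
    fix n assume n: "z \<in> B n \<longleftrightarrow> z \<in> A"
    have "\<forall>i. \<phi> n z i \<longleftrightarrow> sect n x i \<noteq> sect n y i"
    proof
      fix i show "\<phi> n z i \<longleftrightarrow> sect n x i \<noteq> sect n y i"
        using xy[rule_format, of "prod_encode (n, i)"] by (simp add: \<Phi>_def sect_def)
    qed
    from red[OF this] show "(k n (sect n x), k n (sect n (if z \<in> A then y else (\<lambda>i. \<not> y i)))) \<in> G"
      using n by (cases "z \<in> A") (simp_all add: sect_not)
  qed
  ultimately show ?thesis unfolding cantor_reducible_def by blast
qed

lemma cantor_reducible_continuous:
  fixes G :: "('a::second_countable_topology \<times> 'a) set"
  assumes "sym G" "cantor_reducible G B"
  obtains \<psi> where "continuous_on UNIV \<psi>" "\<And>z. \<psi> z \<in> (if z \<in> B then G else G O G)"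
proof -
  obtain k :: "(nat \<Rightarrow> bool) \<Rightarrow> 'a" and \<phi> where
    k: "k \<in> borel \<rightarrow>\<^sub>M borel" and \<phi>: "continuous_on UNIV \<phi>"
    and edge: "\<And>y. (k y, k (\<lambda>i. \<not> y i)) \<in> G"
    and red: "\<And>z x y. \<forall>i. \<phi> z i \<longleftrightarrow> x i \<noteq> y i \<Longrightarrow> (k x, k (if z \<in> B then y else (\<lambda>i. \<not> y i))) \<in> G"
    using assms(2) unfolding cantor_reducible_def by metis
  obtain U where U: "\<And>n::nat. dense_open (U n)" and kU: "continuous_on (\<Inter>n. U n) k"
    by (rule borel_measurable_continuous_on_dense_open[OF k that])
  obtain x y where x: "continuous_on UNIV x" "range x \<subseteq> (\<Inter>n. U n)"
    and y: "continuous_on UNIV y" "range y \<subseteq> (\<Inter>n. U n)"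
    and xy: "\<And>z i. \<phi> z i \<longleftrightarrow> x z i \<noteq> y z i"
    by (rule comeager_continuous_sum[OF U \<phi> that])
  have "continuous_on UNIV (\<lambda>z. (k (x z), k (y z)))"
    by (intro continuous_on_Pair continuous_on_compose2[OF kU x] continuous_on_compose2[OF kU y])
  moreover have "(k (x z), k (y z)) \<in> (if z \<in> B then G else G O G)" for z
  proof (cases "z \<in> B")
    case True
    then show ?thesis using red[of z "x z" "y z"] xy by simp
  next
    case False
    \<comment> \<open>The midpoint \<open>k (\<lambda>i. \<not> y z i)\<close> may come from outside
      the continuity set of \<open>k\<close>; only the two ends of the path have to vary
      continuously with \<open>z\<close>.\<close>
    then have "(k (x z), k (\<lambda>i. \<not> y z i)) \<in> G" using red[of z "x z" "y z"] xy by simp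
    moreover have "(k (\<lambda>i. \<not> y z i), k (y z)) \<in> G" using edge assms(1) by (meson symD)
    ultimately show ?thesis using False by auto
  qed
  ultimately show thesis by (rule that)
qed

section \<open>Contradiction between the encoding and the diagonal set\<close>

text \<open>Bipartiteness enters as the absence of triangles,
  \<open>G \<inter> (G O G) = {}\<close>. The separating set \<open>S\<close> is fixed before
  \<open>D\<close> is chosen against it, and encoding \<open>D\<close> in \<open>G\<close> makes it
  a continuous preimage of \<open>S\<close> after all.\<close>

lemma louveau_jump_not_le:
  fixes G :: "('a::polish_space \<times> 'a) set"
  assumes "sym G" "analytic_set G" "G \<inter> (G O G) = {}" "G \<noteq> {}"
  shows "\<not> louveau_jump G \<preceq>\<^sub>B G"
proof
  assume "louveau_jump G \<preceq>\<^sub>B G"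
  then obtain h where h: "h \<in> borel \<rightarrow>\<^sub>M borel" "graph_hom (louveau_jump G) G h"
    unfolding borel_hom_le_def by blast
  have "borel_separable G (G O G)" using assms(2,3) by (rule analytic_separable_relcomp)
  then obtain S where S: "S \<in> sets borel" "G \<subseteq> S" "(G O G) \<inter> S = {}"
    unfolding borel_separable_def by auto
  obtain D :: "(nat \<Rightarrow> nat) set" where D: "D \<in> sets borel" "\<And>\<psi>. continuous_on UNIV \<psi> \<Longrightarrow> D \<noteq> \<psi> -` S"
    using borel_not_continuous_preimage[OF S(1)] by blast
  obtain a b where "(a, b) \<in> G" using assms(4) by auto
  from D(1) have "clopen_limit D" by (rule borel_imp_clopen_limit)
  then have "cantor_reducible G D"
  proof (induction rule: clopen_limit.induct)
    case (clopen A)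
    then show ?case using cantor_reducible_clopen assms(1) \<open>(a, b) \<in> G\<close> by blast
  next
    case (limit B A)
    then show ?case using cantor_reducible_limit[OF h] by blast
  qed
  then obtain \<psi> where \<psi>: "continuous_on UNIV \<psi>" "\<And>z. \<psi> z \<in> (if z \<in> D then G else G O G)"
    by (rule cantor_reducible_continuous[OF assms(1) _ that])
  have "z \<in> D \<longleftrightarrow> z \<in> \<psi> -` S" for z
    using \<psi>(2)[of z] S(2,3) by (cases "z \<in> D") auto
  then have "D = \<psi> -` S" by (rule set_eqI)
  then show False using D(2)[OF \<psi>(1)] by contradiction
qed

theorem theorem1p1:
  fixes G :: "('a::polish_space \<times> 'a) set"
  assumes "is_graph G"
    and "analytic_set G"
    and "bipartite G"
    and "G \<noteq> {}"
  shows "G \<preceq>\<^sub>B louveau_jump G \<and> \<not> louveau_jump G \<preceq>\<^sub>B G"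
proof
  \<comment> \<open>Sending a point to its constant sequence is a homomorphism into the jump, since
    adjacency holds at every index.\<close>
  have "(\<lambda>x. (\<lambda>_. x)) \<in> borel \<rightarrow>\<^sub>M (borel :: (nat \<Rightarrow> 'a) measure)"
    by (rule measurable_coordinatewise_then_product) simp
  then show "G \<preceq>\<^sub>B louveau_jump G"
    unfolding borel_hom_le_def graph_hom_def louveau_jump_def by blast
  have "G \<inter> (G O G) = {}"
  proof -
    obtain A where "\<forall>(x, y)\<in>G. x \<in> A \<longleftrightarrow> y \<notin> A"
      using assms(3) unfolding bipartite_def by (rule exE)
    then have A: "x \<in> A \<longleftrightarrow> y \<notin> A" if "(x, y) \<in> G" for x y
      using that by auto
    \<comment> \<open>Two of the three vertices of a triangle would lie in the same part.\<close>
    have False if "(x, z) \<in> G" "(x, y) \<in> G" "(y, z) \<in> G" for x y z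
      using A[OF that(1)] A[OF that(2)] A[OF that(3)] by blast
    then show ?thesis by auto
  qed
  then show "\<not> louveau_jump G \<preceq>\<^sub>B G"
    using assms by (intro louveau_jump_not_le) (auto simp: is_graph_def)
qed

end
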